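(* The infinitesimals of two equivalent one-parameter formal deformations of a Reynolds LieDer pair $(L,\mu,R,d)$ are in the same cohomology class: if $(\mu_t,R_t,d_t)$ and $(\mu'_t,R'_t,d'_t)$ are equivalent (i.e. formally isomorphic) one-parameter formal deformations of $(L,\mu,R,d)$, then $(\mu_1,R_1,d_1)$ and $(\mu'_1,R'_1,d'_1)$ define the same class in $\mathcal{H}^2_{\mathrm{RLieDer}}(L,L)$.
   Context: All vector spaces are over a ground field $K$. A Reynolds LieDer pair $(L,\mu,R,d)$ is a Lie algebra $L$ with bracket $\mu=[-,-]$, a linear map $R:L\to L$ (Reynolds operator) with $[Rx,Ry]=R([Rx,y]+[x,Ry]-[Rx,Ry])$, and a derivation $d$ of $L$ with $R\circ d=d\circ R$. A one-parameter formal deformation of $(L,\mu,R,d)$ is a triple of power series $\mu_t=\sum_{i\ge0}\mu_it^i$, $R_t=\sum_{i\ge0}R_it^i$, $d_t=\sum_{i\ge0}d_it^i$, with $\mu_i\in\mathrm{Hom}(\wedge^2L,L)$, $R_i,d_i\in\mathrm{Hom}(L,L)$, $(\mu_0,R_0,d_0)=(\mu,R,d)$, such that $(L[[t]],\mu_t,R_t,d_t)$, with maps extended $K[[t]]$-(bi)linearly, is a Reynolds LieDer pair over $K[[t]]$. Its infinitesimal is $(\mu_1,R_1,d_1)$, which is a $2$-cocycle of the complex below. A formal isomorphism between $(\mu_t,R_t,d_t)$ and $(\mu'_t,R'_t,d'_t)$ is a power series $\psi_t=\sum_{i\ge0}\psi_it^i:L[[t]]\to L[[t]]$ with $\psi_i:L\to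 L$ linear and $\psi_0=\mathrm{Id}_L$, such that $\psi_t\circ\mu'_t=\mu_t\circ(\psi_t\otimes\psi_t)$, $\psi_t\circ R'_t=R_t\circ\psi_t$, $\psi_t\circ d'_t=d_t\circ\psi_t$. Two deformations are equivalent if a formal isomorphism between them exists. Complex with coefficients in the adjoint representation. For $f\in\mathrm{Hom}(\wedge^nL,L)$, $n\ge1$: $$(\delta_{CE}f)(x_1,\dots,x_{n+1})=\sum_{i=1}^{n+1}(-1)^{i+n}[x_i,f(x_1,\dots,\hat x_i,\dots,x_{n+1})]+\sum_{1\le i<j\le n+1}(-1)^{i+j+n+1}f([x_i,x_j],x_1,\dots,\hat x_i,\dots,\hat x_j,\dots,x_{n+1});$$ $\delta_R$ is given by the same formula with the argument bracket $[x_i,x_j]$ replaced by $[x_i,x_j]_R$, where $[x,y]_R=[x,Ry]+[Rx,y]-[Rx,Ry]$, and the action $[x_i,-]$ replaced by $\rho_R(x_i)$, where $\rho_R(x)u=[Rx,u]+R([Rx,u]-[x,u])$; $$(\varphi f)(x_1,\dots,x_n)=f(Rx_1,\dots,Rx_n)-R\sum_{i=1}^nf(Rx_1,\dots,Rx_{i-1},x_i,Rx_{i+1},\dots,Rx_n)+(n-1)Rf(Rx_1,\dots,Rx_n);$$ $$(\Delta f)(x_1,\dots,x_n)=\sum_{i=1}^nf(x_1,\dots,dx_i,\dots,x_n)-d(f(x_1,\dots,x_n)).$$ Put $C^1_R(L,L)=\mathrm{Hom}(L,L)$ and $C^n_R(L,L)=\mathrm{Hom}(\wedge^nL,L)\oplus\mathrm{Hom}(\wedge^{n-1}L,L)$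 for $n\ge2$; $D_R(f)=(\delta_{CE}f,-\varphi f)$ for $n=1$, $D_R(f,g)=(\delta_{CE}f,-\delta_Rg-\varphi f)$ for $n\ge2$; $\Delta(f,g)=(\Delta f,\Delta g)$. Then $\mathfrak{C}^1_{\mathrm{RLieDer}}=C^1_R$, $\mathfrak{C}^n_{\mathrm{RLieDer}}=C^n_R\times C^{n-1}_R$ for $n\ge2$, $\mathfrak{D}_{\mathrm{RLieDer}}(f)=(D_Rf,-\Delta f)$ on degree $1$, and $\mathfrak{D}_{\mathrm{RLieDer}}(F,\tilde F)=(D_RF,\,D_R\tilde F+(-1)^n\Delta F)$ on degree $n\ge2$. A $2$-cochain is a triple $(\mu_1,R_1,d_1)=((\mu_1,R_1),d_1)$. $\mathcal{H}^2_{\mathrm{RLieDer}}(L,L)$ is the space of $2$-cocycles modulo $2$-coboundaries. *)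

theory Defs
  imports
    "HOL-Computational_Algebra.Formal_Power_Series"
    "HOL-Library.Function_Algebras"
    "HOL-Library.Product_Plus"
begin

text \<open>The structures are set up over a commutative ring, because they are needed both over the
  ground field and over its power series ring. Over a field, \<open>module\<close> and \<open>module_hom\<close> are
  vector spaces and linear maps.\<close>

definition alternating_bilinear ::
    "('k::comm_ring_1 \<Rightarrow> 'v::ab_group_add \<Rightarrow> 'v) \<Rightarrow> ('v \<Rightarrow> 'v \<Rightarrow> 'v) \<Rightarrow> bool" where
  "alternating_bilinear scale b \<longleftrightarrow>
     (\<forall>y. module_hom scale scale (\<lambda>x. b x y)) \<and>
     (\<forall>x. module_hom scale scale (\<lambda>y. b x y)) \<and>
     (\<forall>x. b x x = 0)"

locale lie_algebra = module scale
  for scale :: "'k::comm_ring_1 \<Rightarrow> 'v::ab_group_add \<Rightarrow> 'v" +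
  fixes br :: "'v \<Rightarrow> 'v \<Rightarrow> 'v"
  assumes bracket: "alternating_bilinear scale br"
    and jacobi: "br x (br y z) + br y (br z x) + br z (br x y) = 0"

locale reynolds_lieder_pair = lie_algebra scale br
  for scale :: "'k::comm_ring_1 \<Rightarrow> 'v::ab_group_add \<Rightarrow> 'v" and br :: "'v \<Rightarrow> 'v \<Rightarrow> 'v" +
  fixes R d :: "'v \<Rightarrow> 'v"
  assumes R_linear: "module_hom scale scale R"
    and reynolds: "br (R x) (R y) = R (br (R x) y + br x (R y) - br (R x) (R y))"
    and d_linear: "module_hom scale scale d"
    and derivation: "d (br x y) = br (d x) y + br x (d y)"
    and commute: "R \<circ> d = d \<circ> R"

section \<open>Cochain complex\<close>

text \<open>An $n$-cochain is a function on lists that vanishes on all lists whose length is not $n$, so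
  that equality and the vector space operations of cochains are the pointwise ones.\<close>

type_synonym 'v cochain = "'v list \<Rightarrow> 'v"

definition alt_hom ::
    "('k::comm_ring_1 \<Rightarrow> 'v::ab_group_add \<Rightarrow> 'v) \<Rightarrow> nat \<Rightarrow> 'v cochain set" where
  "alt_hom scale n = {f.
     (\<forall>xs. length xs \<noteq> n \<longrightarrow> f xs = 0) \<and>
     (\<forall>xs i. length xs = n \<longrightarrow> i < n \<longrightarrow> module_hom scale scale (\<lambda>x. f (xs[i := x]))) \<and>
     (\<forall>xs i j. length xs = n \<longrightarrow> i < j \<longrightarrow> j < n \<longrightarrow> xs ! i = xs ! j \<longrightarrow> f xs = 0)}"

definition cochain1 :: "('v \<Rightarrow> 'v::zero) \<Rightarrow> 'v cochain" where
  "cochain1 f xs = (case xs of [x] \<Rightarrow> f x | _ \<Rightarrow> 0)"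

definition cochain2 :: "('v \<Rightarrow> 'v \<Rightarrow> 'v::zero) \<Rightarrow> 'v cochain" where
  "cochain2 f xs = (case xs of [x, y] \<Rightarrow> f x y | _ \<Rightarrow> 0)"

text \<open>The list $x_1, \dots, \hat x_i, \dots, x_m$, for \<open>i\<close> counted from 1.\<close>

definition omit :: "nat \<Rightarrow> 'a list \<Rightarrow> 'a list" where
  "omit i xs = take (i - 1) xs @ drop i xs"

text \<open>Here \<open>b\<close> is the bracket on the arguments and \<open>act\<close> the action on the values.\<close>

definition CE_differential ::
    "('k::comm_ring_1 \<Rightarrow> 'v::ab_group_add \<Rightarrow> 'v) \<Rightarrow> ('v \<Rightarrow> 'v \<Rightarrow> 'v) \<Rightarrow> ('v \<Rightarrow> 'v \<Rightarrow> 'v) \<Rightarrow>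
     nat \<Rightarrow> 'v cochain \<Rightarrow> 'v cochain" where
  "CE_differential scale b act n f xs =
     (if length xs = n + 1 then
        (\<Sum>i = 1..n + 1. scale ((- 1) ^ (i + n)) (act (xs ! (i - 1)) (f (omit i xs)))) +
        (\<Sum>j = 1..n + 1. \<Sum>i = 1..<j. scale ((- 1) ^ (i + j + n + 1))
           (f (b (xs ! (i - 1)) (xs ! (j - 1)) # omit i (omit j xs))))
      else 0)"

context
  fixes scale :: "'k::comm_ring_1 \<Rightarrow> 'v::ab_group_add \<Rightarrow> 'v"
    and br :: "'v \<Rightarrow> 'v \<Rightarrow> 'v"
    and R d :: "'v \<Rightarrow> 'v"
begin

definition bracket_R :: "'v \<Rightarrow> 'v \<Rightarrow> 'v" where
  "bracket_R x y = br x (R y) + br (R x) y - br (R x) (R y)"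

definition rho_R :: "'v \<Rightarrow> 'v \<Rightarrow> 'v" where
  "rho_R x u = br (R x) u + R (br (R x) u - br x u)"

definition delta_CE :: "nat \<Rightarrow> 'v cochain \<Rightarrow> 'v cochain" where
  "delta_CE = CE_differential scale br br"

definition delta_R :: "nat \<Rightarrow> 'v cochain \<Rightarrow> 'v cochain" where
  "delta_R = CE_differential scale bracket_R rho_R"

definition phi :: "nat \<Rightarrow> 'v cochain \<Rightarrow> 'v cochain" where
  "phi n f xs =
     (if length xs = n then
        f (map R xs) - R (\<Sum>i<n. f ((map R xs)[i := xs ! i]))
        + scale (of_nat (n - 1)) (R (f (map R xs)))
      else 0)"

definition Delta :: "nat \<Rightarrow> 'v cochain \<Rightarrow> 'v cochain" where
  "Delta n f xs =
     (if length xs = n then (\<Sum>i<n. f (xs[i := d (xs ! i)])) - d (f xs) else 0)"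

text \<open>A cochain of degree $n$ is always a pair. Where the complex has only one component, the
  second entry is zero: $C^1_R(L,L)$ consists of the pairs $(f, 0)$, and $C^0_R(L,L) = 0$.\<close>

definition cochains_R :: "nat \<Rightarrow> ('v cochain \<times> 'v cochain) set" where
  "cochains_R n =
     (if n = 0 then {0}
      else if n = 1 then alt_hom scale 1 \<times> {0}
      else alt_hom scale n \<times> alt_hom scale (n - 1))"

definition D_R :: "nat \<Rightarrow> 'v cochain \<times> 'v cochain \<Rightarrow> 'v cochain \<times> 'v cochain" where
  "D_R n = (\<lambda>(f, g).
     (delta_CE n f, if n = 1 then - phi n f else - delta_R (n - 1) g - phi n f))"

text \<open>The map $(-1)^n\Delta$ on $C^n_R(L,L)$. The second component of a cochain has degree $n - 1$.\<close>

definition signed_Delta :: "nat \<Rightarrow> 'v cochain \<times> 'v cochain \<Rightarrow> 'v cochain \<times> 'v cochain" where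
  "signed_Delta n = (\<lambda>(f, g).
     (\<lambda>xs. scale ((- 1) ^ n) (Delta n f xs), \<lambda>xs. scale ((- 1) ^ n) (Delta (n - 1) g xs)))"

definition RLD_cochains ::
    "nat \<Rightarrow> (('v cochain \<times> 'v cochain) \<times> ('v cochain \<times> 'v cochain)) set" where
  "RLD_cochains n = cochains_R n \<times> cochains_R (n - 1)"

definition D_RLD ::
    "nat \<Rightarrow> ('v cochain \<times> 'v cochain) \<times> ('v cochain \<times> 'v cochain) \<Rightarrow>
     ('v cochain \<times> 'v cochain) \<times> ('v cochain \<times> 'v cochain)" where
  "D_RLD n = (\<lambda>(F, F').
     (D_R n F, if n = 1 then signed_Delta n F else D_R (n - 1) F' + signed_Delta n F))"

definition RLD_cocycles ::
    "nat \<Rightarrow> (('v cochain \<times> 'v cochain) \<times> ('v cochain \<times> 'v cochain)) set" where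
  "RLD_cocycles n = {c \<in> RLD_cochains n. D_RLD n c = 0}"

definition RLD_coboundaries ::
    "nat \<Rightarrow> (('v cochain \<times> 'v cochain) \<times> ('v cochain \<times> 'v cochain)) set" where
  "RLD_coboundaries n = (if n = 1 then {0} else D_RLD (n - 1) ` RLD_cochains (n - 1))"

definition RLD_cohomologous ::
    "nat \<Rightarrow> (('v cochain \<times> 'v cochain) \<times> ('v cochain \<times> 'v cochain)) rel" where
  "RLD_cohomologous n =
     {(a, b). a \<in> RLD_cocycles n \<and> b \<in> RLD_cocycles n \<and> a - b \<in> RLD_coboundaries n}"

definition RLD_cohomology ::
    "nat \<Rightarrow> (('v cochain \<times> 'v cochain) \<times> ('v cochain \<times> 'v cochain)) set set" where
  "RLD_cohomology n = RLD_cocycles n // RLD_cohomologous n"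

definition RLD_class ::
    "nat \<Rightarrow> ('v cochain \<times> 'v cochain) \<times> ('v cochain \<times> 'v cochain) \<Rightarrow>
     (('v cochain \<times> 'v cochain) \<times> ('v cochain \<times> 'v cochain)) set" where
  "RLD_class n c = RLD_cohomologous n `` {c}"

end

section \<open>Formal deformations\<close>

text \<open>$L[[t]]$ is \<open>'v fps\<close>, and a power series of maps is its sequence of coefficients. The
  extensions to $L[[t]]$ are the ones that moreover commute with infinite sums $\sum_i x_i t^i$.\<close>

definition fps_scale ::
    "('k \<Rightarrow> 'v \<Rightarrow> 'v) \<Rightarrow> 'k::comm_ring_1 fps \<Rightarrow> 'v::ab_group_add fps \<Rightarrow> 'v fps" where
  "fps_scale scale a x = Abs_fps (\<lambda>n. \<Sum>i\<le>n. scale (fps_nth a i) (fps_nth x (n - i)))"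

definition fps_extend :: "(nat \<Rightarrow> 'v \<Rightarrow> 'v) \<Rightarrow> 'v::ab_group_add fps \<Rightarrow> 'v fps" where
  "fps_extend f x = Abs_fps (\<lambda>n. \<Sum>i\<le>n. f i (fps_nth x (n - i)))"

definition fps_extend2 ::
    "(nat \<Rightarrow> 'v \<Rightarrow> 'v \<Rightarrow> 'v) \<Rightarrow> 'v::ab_group_add fps \<Rightarrow> 'v fps \<Rightarrow> 'v fps" where
  "fps_extend2 b x y =
     Abs_fps (\<lambda>n. \<Sum>i\<le>n. \<Sum>j\<le>n - i. b i (fps_nth x j) (fps_nth y (n - i - j)))"

definition formal_deformation ::
    "('k::comm_ring_1 \<Rightarrow> 'v::ab_group_add \<Rightarrow> 'v) \<Rightarrow> ('v \<Rightarrow> 'v \<Rightarrow> 'v) \<Rightarrow> ('v \<Rightarrow> 'v) \<Rightarrow> ('v \<Rightarrow> 'v) \<Rightarrow>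
     (nat \<Rightarrow> 'v \<Rightarrow> 'v \<Rightarrow> 'v) \<Rightarrow> (nat \<Rightarrow> 'v \<Rightarrow> 'v) \<Rightarrow> (nat \<Rightarrow> 'v \<Rightarrow> 'v) \<Rightarrow> bool" where
  "formal_deformation scale br R d \<mu>t Rt dt \<longleftrightarrow>
     (\<forall>i. alternating_bilinear scale (\<mu>t i)) \<and>
     (\<forall>i. module_hom scale scale (Rt i)) \<and>
     (\<forall>i. module_hom scale scale (dt i)) \<and>
     \<mu>t 0 = br \<and> Rt 0 = R \<and> dt 0 = d \<and>
     reynolds_lieder_pair (fps_scale scale) (fps_extend2 \<mu>t) (fps_extend Rt) (fps_extend dt)"

definition infinitesimal ::
    "(nat \<Rightarrow> 'v \<Rightarrow> 'v \<Rightarrow> 'v) \<Rightarrow> (nat \<Rightarrow> 'v \<Rightarrow> 'v) \<Rightarrow> (nat \<Rightarrow> 'v \<Rightarrow> 'v::ab_group_add) \<Rightarrow>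
     ('v cochain \<times> 'v cochain) \<times> ('v cochain \<times> 'v cochain)" where
  "infinitesimal \<mu>t Rt dt = ((cochain2 (\<mu>t 1), cochain1 (Rt 1)), (cochain1 (dt 1), 0))"

definition formal_isomorphism ::
    "('k::comm_ring_1 \<Rightarrow> 'v::ab_group_add \<Rightarrow> 'v) \<Rightarrow>
     (nat \<Rightarrow> 'v \<Rightarrow> 'v \<Rightarrow> 'v) \<Rightarrow> (nat \<Rightarrow> 'v \<Rightarrow> 'v) \<Rightarrow> (nat \<Rightarrow> 'v \<Rightarrow> 'v) \<Rightarrow>
     (nat \<Rightarrow> 'v \<Rightarrow> 'v \<Rightarrow> 'v) \<Rightarrow> (nat \<Rightarrow> 'v \<Rightarrow> 'v) \<Rightarrow> (nat \<Rightarrow> 'v \<Rightarrow> 'v) \<Rightarrow>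
     (nat \<Rightarrow> 'v \<Rightarrow> 'v) \<Rightarrow> bool" where
  "formal_isomorphism scale \<mu>t Rt dt \<mu>t' Rt' dt' \<psi>t \<longleftrightarrow>
     (\<forall>i. module_hom scale scale (\<psi>t i)) \<and> \<psi>t 0 = id \<and>
     (\<forall>x y. fps_extend \<psi>t (fps_extend2 \<mu>t' x y) =
            fps_extend2 \<mu>t (fps_extend \<psi>t x) (fps_extend \<psi>t y)) \<and>
     fps_extend \<psi>t \<circ> fps_extend Rt' = fps_extend Rt \<circ> fps_extend \<psi>t \<and>
     fps_extend \<psi>t \<circ> fps_extend dt' = fps_extend dt \<circ> fps_extend \<psi>t"

definition equivalent_deformations ::
    "('k::comm_ring_1 \<Rightarrow> 'v::ab_group_add \<Rightarrow> 'v) \<Rightarrow>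
     (nat \<Rightarrow> 'v \<Rightarrow> 'v \<Rightarrow> 'v) \<Rightarrow> (nat \<Rightarrow> 'v \<Rightarrow> 'v) \<Rightarrow> (nat \<Rightarrow> 'v \<Rightarrow> 'v) \<Rightarrow>
     (nat \<Rightarrow> 'v \<Rightarrow> 'v \<Rightarrow> 'v) \<Rightarrow> (nat \<Rightarrow> 'v \<Rightarrow> 'v) \<Rightarrow> (nat \<Rightarrow> 'v \<Rightarrow> 'v) \<Rightarrow> bool" where
  "equivalent_deformations scale \<mu>t Rt dt \<mu>t' Rt' dt' \<longleftrightarrow>
     (\<exists>\<psi>t. formal_isomorphism scale \<mu>t Rt dt \<mu>t' Rt' dt' \<psi>t)"

end

theory Submission imports Defs
begin

text \<open>
  Everything is read off from the coefficient of $t$. Evaluated on constant power series, this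
  coefficient of the Jacobi identity, of the Reynolds identity, of the Leibniz rule and of
  $R_t d_t = d_t R_t$ gives four identities for $(\mu_1, R_1, d_1)$. Up to sign they are the four
  components of the cocycle condition in degree 2 (\<open>infinitesimal_in_cocycles\<close>).

  Likewise the coefficient of $t$ in the three identities for a formal isomorphism $\psi_t$ reads
  \[ \mu_1 - \mu_1' = -\delta_{CE} \psi_1, \quad R_1 - R_1' = \psi_1 R - R \psi_1, \quad
     d_1 - d_1' = \psi_1 d - d \psi_1, \]
  which says that the infinitesimals differ by the coboundary of $-\psi_1$
  (\<open>infinitesimal_diff_coboundary\<close>).

  That the classes then coincide as sets, and not only that their representatives are related,
  requires the relation to be an equivalence. This follows from the additivity of the differential
  (\<open>D_RLD_diff\<close>), which makes the coboundaries a subgroup.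
\<close>

section \<open>Alternating bilinear maps and cochains of low degree\<close>

lemma alternating_bilinear_antisym:
  assumes "alternating_bilinear scale b"
  shows "b x y = - b y x"
proof -
  have l: "b (u + v) w = b u w + b v w" and r: "b w (u + v) = b w u + b w v" and z: "b u u = 0"
    for u v w
    using assms by (auto simp: alternating_bilinear_def dest: module_hom.add)
  have "b (x + y) (x + y) = 0"
    by (rule z)
  then show ?thesis
    unfolding l r by (simp add: z eq_neg_iff_add_eq_0 add.commute)
qed

lemma cochain1_in_alt_hom:
  assumes "module_hom scale scale f"
  shows "cochain1 f \<in> alt_hom scale 1"
  unfolding alt_hom_def using assms
  by (auto simp: cochain1_def length_Suc_conv split: list.splits)

lemma cochain2_in_alt_hom:
  assumes "alternating_bilinear scale b"
  shows "cochain2 b \<in> alt_hom scale 2"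
proof -
  have "module_hom scale scale (\<lambda>x. cochain2 b (xs[i := x]))" if len: "length xs = 2" and i: "i < 2"
    for xs i
  proof -
    obtain u v where xs: "xs = [u, v]"
      using len by (auto simp: length_Suc_conv numeral_2_eq_2)
    from i consider "i = 0" | "i = 1"
      by linarith
    then show ?thesis
      using assms by cases (auto simp: xs cochain2_def alternating_bilinear_def)
  qed
  moreover have "cochain2 b xs = 0"
    if len: "length xs = 2" and ij: "i < j" "j < 2" and eq: "xs ! i = xs ! j" for xs i j
  proof -
    have "i = 0" "j = 1"
      using ij by auto
    then show ?thesis
      using len eq assms
      by (auto simp: length_Suc_conv numeral_2_eq_2 cochain2_def alternating_bilinear_def)
  qed
  ultimately show ?thesis
    by (auto simp: alt_hom_def cochain2_def split: list.splits)
qed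

lemma (in module) CE_differential_1:
  "CE_differential scale b act 1 f [x, y] = act x (f [y]) - act y (f [x]) - f [b x y]"
  by (simp add: CE_differential_def omit_def numeral_2_eq_2)

lemma (in module) CE_differential_2:
  "CE_differential scale b act 2 f [x, y, z] =
     - act x (f [y, z]) + act y (f [x, z]) - act z (f [x, y])
     + f [b x y, z] - f [b x z, y] + f [b y z, x]"
  by (simp add: CE_differential_def omit_def numeral_2_eq_2 numeral_3_eq_3)

section \<open>The cohomology relation\<close>

lemma (in module) zero_in_cochains: "0 \<in> RLD_cochains scale n"
proof -
  have "0 \<in> alt_hom scale k" for k
    using module_axioms by (auto simp: alt_hom_def module_hom_iff)
  then show ?thesis
    by (auto simp: RLD_cochains_def cochains_R_def zero_prod_def)
qed

lemma alt_hom_diff: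
  assumes "f \<in> alt_hom scale n" and "g \<in> alt_hom scale n"
  shows "f - g \<in> alt_hom scale n"
  using assms unfolding alt_hom_def
  by (auto simp: module_hom_iff module.scale_right_diff_distrib)

lemma RLD_cochains_diff:
  assumes "a \<in> RLD_cochains scale n" and "b \<in> RLD_cochains scale n"
  shows "a - b \<in> RLD_cochains scale n"
  using assms
  by (auto simp: RLD_cochains_def cochains_R_def zero_prod_def alt_hom_diff split: if_splits)

lemma (in module) CE_differential_diff:
  assumes "\<And>x u v. act x (u - v) = act x u - act x v"
  shows "CE_differential scale b act n (f - g) =
         CE_differential scale b act n f - CE_differential scale b act n g"
  by (rule ext)
    (simp only: CE_differential_def minus_apply assms scale_right_diff_distrib sum_subtractf
      add_diff_add diff_zero split: if_split, simp)

context reynolds_lieder_pair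
begin

lemma br_diff_left: "br (x - y) z = br x z - br y z"
  using bracket by (auto simp: alternating_bilinear_def dest: module_hom.diff)

lemma br_diff_right: "br z (x - y) = br z x - br z y"
  using bracket by (auto simp: alternating_bilinear_def dest: module_hom.diff)

lemma br_antisym: "br x y = - br y x"
  by (rule alternating_bilinear_antisym[OF bracket])

lemmas R_diff = module_hom.diff[OF R_linear]
lemmas R_add = module_hom.add[OF R_linear]
lemmas d_diff = module_hom.diff[OF d_linear]

lemma delta_CE_diff: "delta_CE scale br n (f - g) = delta_CE scale br n f - delta_CE scale br n g"
  unfolding delta_CE_def by (rule CE_differential_diff) (rule br_diff_right)

lemma delta_R_diff: "delta_R scale br R n (f - g) = delta_R scale br R n f - delta_R scale br R n g"
  unfolding delta_R_def by (rule CE_differential_diff) (simp add: rho_R_def br_diff_right R_diff)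

lemma phi_diff: "phi scale R n (f - g) = phi scale R n f - phi scale R n g"
  by (rule ext)
    (simp add: phi_def R_diff sum_subtractf scale_right_diff_distrib)

lemma Delta_diff: "Delta d n (f - g) = Delta d n f - Delta d n g"
  by (rule ext) (simp add: Delta_def d_diff sum_subtractf)

lemma D_R_diff: "D_R scale br R n (a - b) = D_R scale br R n a - D_R scale br R n b"
  by (cases a; cases b) (simp add: D_R_def delta_CE_diff delta_R_diff phi_diff)

lemma signed_Delta_diff:
  "signed_Delta scale d n (a - b) = signed_Delta scale d n a - signed_Delta scale d n b"
  by (cases a; cases b)
    (simp add: signed_Delta_def Delta_diff scale_right_diff_distrib fun_eq_iff)

lemma D_RLD_diff: "D_RLD scale br R d n (a - b) = D_RLD scale br R d n a - D_RLD scale br R d n b"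
  by (cases "n = 1")
    (simp_all only: D_RLD_def split_beta fst_diff snd_diff D_R_diff signed_Delta_diff prod_eq_iff
      fst_conv snd_conv add_diff_add simp_thms if_True if_False)

lemma coboundaries_diff:
  assumes "a \<in> RLD_coboundaries scale br R d n" and "b \<in> RLD_coboundaries scale br R d n"
  shows "a - b \<in> RLD_coboundaries scale br R d n"
proof (cases "n = 1")
  case False
  then obtain a' b' where "a' \<in> RLD_cochains scale (n - 1)" "b' \<in> RLD_cochains scale (n - 1)"
    and ab: "a = D_RLD scale br R d (n - 1) a'" "b = D_RLD scale br R d (n - 1) b'"
    using assms unfolding RLD_coboundaries_def by auto
  then have "a' - b' \<in> RLD_cochains scale (n - 1)"
    by (intro RLD_cochains_diff)
  then show ?thesis
    using False by (simp add: RLD_coboundaries_def ab flip: D_RLD_diff)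
qed (use assms in \<open>simp add: RLD_coboundaries_def\<close>)

lemma zero_in_coboundaries: "0 \<in> RLD_coboundaries scale br R d n"
proof -
  have "D_RLD scale br R d (n - 1) 0 = 0"
    using D_RLD_diff[of "n - 1" 0 0] by simp
  then show ?thesis
    unfolding RLD_coboundaries_def using zero_in_cochains[of "n - 1"] by (auto intro!: rev_image_eqI)
qed

lemma equiv_cohomologous:
  "equiv (RLD_cocycles scale br R d n) (RLD_cohomologous scale br R d n)"
proof -
  let ?B = "RLD_coboundaries scale br R d n"
  have minus: "b - a \<in> ?B" if "a - b \<in> ?B" for a b
    using coboundaries_diff[OF zero_in_coboundaries that] by simp
  have plus: "a - c \<in> ?B" if "a - b \<in> ?B" "b - c \<in> ?B" for a b c
    using coboundaries_diff[OF that(1) minus[OF that(2)]] by simp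
  show ?thesis
    by (rule equivI)
      (auto simp: RLD_cohomologous_def refl_on_def zero_in_coboundaries
        intro!: symI transI intro: minus plus)
qed

section \<open>Degree 2 of the complex on concrete maps\<close>

text \<open>
  The four hypotheses are the linearizations at $(\mu, R, d)$ of the Jacobi identity, the Reynolds
  identity, the Leibniz rule and the commutation of $R$ and $d$. The components of the differential
  have the same terms in another arrangement; antisymmetry of the bracket and of \<open>m\<close> accounts for
  the difference.
\<close>
lemma cocycle2I:
  assumes m: "alternating_bilinear scale m"
    and r: "module_hom scale scale r" and e: "module_hom scale scale e"
    and jacobi1: "\<And>x y z. br x (m y z) + m x (br y z) + (br y (m z x) + m y (br z x))
                  + (br z (m x y) + m z (br x y)) = 0"
    and reynolds1: "\<And>x y. m (R x) (R y) + br (r x) (R y) + br (R x) (r y) =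
                  r (br (R x) y + br x (R y) - br (R x) (R y))
                  + R (m (R x) y + br (r x) y + (m x (R y) + br x (r y))
                       - (m (R x) (R y) + br (r x) (R y) + br (R x) (r y)))"
    and derivation1: "\<And>x y. e (br x y) + d (m x y) = m (d x) y + br (e x) y + (m x (d y) + br x (e y))"
    and commute1: "\<And>x. r (d x) + R (e x) = e (R x) + d (r x)"
  shows "((cochain2 m, cochain1 r), (cochain1 e, 0)) \<in> RLD_cocycles scale br R d 2"
proof -
  have m_antisym: "m x y = - m y x" for x y
    by (rule alternating_bilinear_antisym[OF m])
  have m_neg: "m (- x) y = - m x y" for x y
    using m by (auto simp: alternating_bilinear_def dest: module_hom.neg)
  have br_neg: "br x (- y) = - br x y" for x y
    using br_diff_right[of x 0 y] br_diff_right[of x 0 0] by simp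

  have "delta_CE scale br 2 (cochain2 m) = 0"
  proof
    fix xs
    show "delta_CE scale br 2 (cochain2 m) xs = 0 xs"
    proof (cases "length xs = 3")
      case True
      then obtain x y z where xs: "xs = [x, y, z]"
        by (auto simp: length_Suc_conv numeral_3_eq_3)
      have "br y (m x z) = - br y (m z x)" "m (br x z) y = m y (br z x)"
        "m (br x y) z = - m z (br x y)" "m (br y z) x = - m x (br y z)"
        using m_antisym[of x z] m_antisym[of "br x y" z] m_antisym[of "br y z" x]
          m_antisym[of "br z x" y] br_antisym[of x z]
        by (simp_all add: br_neg m_neg)
      then have "delta_CE scale br 2 (cochain2 m) xs =
          - (br x (m y z) + m x (br y z) + (br y (m z x) + m y (br z x))
             + (br z (m x y) + m z (br x y)))"
        unfolding delta_CE_def xs CE_differential_2 by (simp add: cochain2_def)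
      then show ?thesis
        by (simp only: jacobi1) simp
    qed (simp add: delta_CE_def CE_differential_def)
  qed
  moreover have "delta_R scale br R 1 (cochain1 r) + phi scale R 2 (cochain2 m) = 0"
  proof
    fix xs
    show "(delta_R scale br R 1 (cochain1 r) + phi scale R 2 (cochain2 m)) xs = 0 xs"
    proof (cases "length xs = 2")
      case True
      then obtain x y where xs: "xs = [x, y]"
        by (auto simp: length_Suc_conv numeral_2_eq_2)
      have phi_eq: "phi scale R 2 (cochain2 m) xs =
          m (R x) (R y) - R (m x (R y) + m (R x) y) + R (m (R x) (R y))"
        by (simp add: xs phi_def cochain2_def numeral_2_eq_2)
      have delta_eq: "delta_R scale br R 1 (cochain1 r) xs =
          br (R x) (r y) + R (br (R x) (r y) - br x (r y))
          + br (r x) (R y) + R (br (r x) (R y) - br (r x) y)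
          - r (br (R x) y + br x (R y) - br (R x) (R y))"
        unfolding delta_R_def xs CE_differential_1
        using br_antisym[of "R y" "r x"] br_antisym[of y "r x"]
        by (simp add: cochain1_def rho_R_def bracket_R_def R_diff R_add module_hom.neg[OF R_linear]
            algebra_simps)
      have "(delta_R scale br R 1 (cochain1 r) + phi scale R 2 (cochain2 m)) xs =
          m (R x) (R y) + br (r x) (R y) + br (R x) (r y)
          - (r (br (R x) y + br x (R y) - br (R x) (R y))
             + R (m (R x) y + br (r x) y + (m x (R y) + br x (r y))
                  - (m (R x) (R y) + br (r x) (R y) + br (R x) (r y))))"
        unfolding plus_fun_apply phi_eq delta_eq by (simp add: R_diff R_add algebra_simps)
      also have "\<dots> = 0"
        by (rule iffD2[OF right_minus_eq reynolds1])
      finally show ?thesis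
        by simp
    qed (simp add: delta_R_def phi_def CE_differential_def)
  qed
  moreover have "delta_CE scale br 1 (cochain1 e) + Delta d 2 (cochain2 m) = 0"
  proof
    fix xs
    show "(delta_CE scale br 1 (cochain1 e) + Delta d 2 (cochain2 m)) xs = 0 xs"
    proof (cases "length xs = 2")
      case True
      then obtain x y where xs: "xs = [x, y]"
        by (auto simp: length_Suc_conv numeral_2_eq_2)
      have Delta_eq: "Delta d 2 (cochain2 m) xs = m (d x) y + m x (d y) - d (m x y)"
        by (simp add: xs Delta_def cochain2_def numeral_2_eq_2)
      have delta_eq: "delta_CE scale br 1 (cochain1 e) xs = br x (e y) + br (e x) y - e (br x y)"
        unfolding delta_CE_def xs CE_differential_1
        using br_antisym[of y "e x"] by (simp add: cochain1_def)
      have "(delta_CE scale br 1 (cochain1 e) + Delta d 2 (cochain2 m)) xs =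
          m (d x) y + br (e x) y + (m x (d y) + br x (e y)) - (e (br x y) + d (m x y))"
        unfolding plus_fun_apply Delta_eq delta_eq by (simp add: algebra_simps)
      also have "\<dots> = 0"
        by (rule iffD2[OF right_minus_eq derivation1[symmetric]])
      finally show ?thesis
        by simp
    qed (simp add: delta_CE_def Delta_def CE_differential_def)
  qed
  moreover have "Delta d 1 (cochain1 r) - phi scale R 1 (cochain1 e) = 0"
  proof
    fix xs
    show "(Delta d 1 (cochain1 r) - phi scale R 1 (cochain1 e)) xs = 0 xs"
    proof (cases "length xs = 1")
      case True
      then obtain x where xs: "xs = [x]"
        by (auto simp: length_Suc_conv)
      show ?thesis
        using commute1[of x] by (simp add: xs phi_def Delta_def cochain1_def algebra_simps)
    qed (simp add: phi_def Delta_def)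
  qed
  ultimately have "D_RLD scale br R d 2 ((cochain2 m, cochain1 r), (cochain1 e, 0)) = 0"
    by (auto simp: D_RLD_def D_R_def signed_Delta_def zero_prod_def fun_eq_iff neg_eq_iff_add_eq_0 algebra_simps)
  moreover have "((cochain2 m, cochain1 r), (cochain1 e, 0)) \<in> RLD_cochains scale 2"
    using cochain2_in_alt_hom[OF m] cochain1_in_alt_hom[OF r] cochain1_in_alt_hom[OF e]
    by (simp add: RLD_cochains_def cochains_R_def)
  ultimately show ?thesis
    by (simp add: RLD_cocycles_def)
qed

lemma D_RLD_1:
  "D_RLD scale br R d 1 ((cochain1 p, 0), 0) =
     ((cochain2 (\<lambda>x y. br x (p y) + br (p x) y - p (br x y)), cochain1 (\<lambda>x. R (p x) - p (R x))),
      (cochain1 (\<lambda>x. d (p x) - p (d x)), 0))"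
proof -
  have "delta_CE scale br 1 (cochain1 p) = cochain2 (\<lambda>x y. br x (p y) + br (p x) y - p (br x y))"
  proof
    fix xs
    show "delta_CE scale br 1 (cochain1 p) xs =
        cochain2 (\<lambda>x y. br x (p y) + br (p x) y - p (br x y)) xs"
    proof (cases "length xs = 2")
      case True
      then obtain x y where xs: "xs = [x, y]"
        by (auto simp: length_Suc_conv numeral_2_eq_2)
      show ?thesis
        unfolding delta_CE_def xs CE_differential_1
        using br_antisym[of y "p x"] by (simp add: cochain1_def cochain2_def)
    qed (auto simp: delta_CE_def CE_differential_def cochain2_def split: list.splits)
  qed
  moreover have "- phi scale R 1 (cochain1 p) = cochain1 (\<lambda>x. R (p x) - p (R x))"
    by (auto simp: fun_eq_iff phi_def cochain1_def split: list.splits)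
  moreover have "(\<lambda>xs. - Delta d 1 (cochain1 p) xs) = cochain1 (\<lambda>x. d (p x) - p (d x))"
    by (auto simp: fun_eq_iff Delta_def cochain1_def split: list.splits)
  moreover have "Delta d 0 0 xs = 0" for xs
    using module_hom.zero[OF d_linear] by (simp add: Delta_def)
  ultimately show ?thesis
    by (simp add: D_RLD_def D_R_def signed_Delta_def zero_prod_def fun_eq_iff)
qed

end

section \<open>First-order coefficients\<close>

lemma fps_nth_extend_0: "fps_nth (fps_extend f x) 0 = f 0 (fps_nth x 0)"
  by (simp add: fps_extend_def)

lemma fps_nth_extend_1:
  "fps_nth (fps_extend f x) (Suc 0) = f 0 (fps_nth x (Suc 0)) + f (Suc 0) (fps_nth x 0)"
  by (simp add: fps_extend_def)

lemma fps_nth_extend2_0: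
  "fps_nth (fps_extend2 b x y) 0 = b 0 (fps_nth x 0) (fps_nth y 0)"
  by (simp add: fps_extend2_def)

lemma fps_nth_extend2_1:
  "fps_nth (fps_extend2 b x y) (Suc 0) =
     b 0 (fps_nth x 0) (fps_nth y (Suc 0)) + b 0 (fps_nth x (Suc 0)) (fps_nth y 0)
     + b (Suc 0) (fps_nth x 0) (fps_nth y 0)"
  by (simp add: fps_extend2_def)

lemmas fps_nth_extend = fps_nth_extend_0 fps_nth_extend_1 fps_nth_extend2_0 fps_nth_extend2_1

text \<open>An identity over $L[[t]]$ gives its linearization on $L$ when it is evaluated on constant
  series: there the arguments contribute nothing to the coefficient of $t$, which therefore
  collects exactly the first-order terms of the maps.\<close>
lemma infinitesimal_in_cocycles:
  assumes pair: "reynolds_lieder_pair scale br R d"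
    and deform: "formal_deformation scale br R d \<mu>t Rt dt"
  shows "infinitesimal \<mu>t Rt dt \<in> RLD_cocycles scale br R d 2"
proof -
  interpret L: reynolds_lieder_pair scale br R d
    by (rule pair)
  have alt: "alternating_bilinear scale (\<mu>t 1)"
    and hom: "module_hom scale scale (Rt 1)" "module_hom scale scale (dt 1)"
    and start: "\<mu>t 0 = br" "Rt 0 = R" "dt 0 = d"
    and ext: "reynolds_lieder_pair (fps_scale scale) (fps_extend2 \<mu>t) (fps_extend Rt) (fps_extend dt)"
    using deform by (auto simp: formal_deformation_def)
  interpret E: reynolds_lieder_pair "fps_scale scale" "fps_extend2 \<mu>t" "fps_extend Rt" "fps_extend dt"
    by (rule ext)
  have zero: "br x 0 = 0" "br 0 x = 0" "R 0 = 0" "d 0 = 0" for x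
    using L.br_diff_left[of 0 0 x] L.br_diff_right[of x 0 0] L.R_diff[of 0 0] L.d_diff[of 0 0]
    by simp_all
  let ?c = fps_const
  note coeffs = fps_nth_extend start zero
  show ?thesis
    unfolding infinitesimal_def
  proof (rule L.cocycle2I[OF alt hom])
    fix x y z
    show "br x (\<mu>t 1 y z) + \<mu>t 1 x (br y z) + (br y (\<mu>t 1 z x) + \<mu>t 1 y (br z x))
        + (br z (\<mu>t 1 x y) + \<mu>t 1 z (br x y)) = 0"
      using arg_cong[OF E.jacobi[of "?c x" "?c y" "?c z"], of "\<lambda>s. fps_nth s 1"]
      by (simp add: coeffs)
    show "\<mu>t 1 (R x) (R y) + br (Rt 1 x) (R y) + br (R x) (Rt 1 y) =
        Rt 1 (br (R x) y + br x (R y) - br (R x) (R y))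
        + R (\<mu>t 1 (R x) y + br (Rt 1 x) y + (\<mu>t 1 x (R y) + br x (Rt 1 y))
             - (\<mu>t 1 (R x) (R y) + br (Rt 1 x) (R y) + br (R x) (Rt 1 y)))"
      using arg_cong[OF E.reynolds[of "?c x" "?c y"], of "\<lambda>s. fps_nth s 1"]
      by (simp add: coeffs algebra_simps)
    show "dt 1 (br x y) + d (\<mu>t 1 x y) =
        \<mu>t 1 (d x) y + br (dt 1 x) y + (\<mu>t 1 x (d y) + br x (dt 1 y))"
      using arg_cong[OF E.derivation[of "?c x" "?c y"], of "\<lambda>s. fps_nth s 1"]
      by (simp add: coeffs algebra_simps)
    show "Rt 1 (d x) + R (dt 1 x) = dt 1 (R x) + d (Rt 1 x)"
      using arg_cong[OF fun_cong[OF E.commute, of "?c x"], of "\<lambda>s. fps_nth s 1"]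
      by (simp add: coeffs algebra_simps)
  qed
qed

text \<open>Since $\psi_0$ is the identity, the coefficient of $t$ of each compatibility condition
  of $\psi_t$ contains one term of each infinitesimal, and its remaining terms make up a component
  of the differential of $\psi_1$. As $\psi_t$ maps the primed structure to the unprimed one,
  solving for unprimed minus primed gives the coboundary of $-\psi_1$.\<close>
lemma infinitesimal_diff_coboundary:
  assumes pair: "reynolds_lieder_pair scale br R d"
    and deform: "formal_deformation scale br R d \<mu>t Rt dt"
    and deform': "formal_deformation scale br R d \<mu>t' Rt' dt'"
    and iso: "formal_isomorphism scale \<mu>t Rt dt \<mu>t' Rt' dt' \<psi>t"
  shows "infinitesimal \<mu>t Rt dt - infinitesimal \<mu>t' Rt' dt' \<in> RLD_coboundaries scale br R d 2"
proof -
  interpret L: reynolds_lieder_pair scale br R d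
    by (rule pair)
  have start: "\<mu>t 0 = br" "Rt 0 = R" "dt 0 = d" "\<mu>t' 0 = br" "Rt' 0 = R" "dt' 0 = d"
    using deform deform' by (auto simp: formal_deformation_def)
  have hom: "module_hom scale scale (\<psi>t 1)" and \<psi>0: "\<psi>t 0 = id"
    and iso_br: "fps_extend \<psi>t (fps_extend2 \<mu>t' x y) =
              fps_extend2 \<mu>t (fps_extend \<psi>t x) (fps_extend \<psi>t y)"
    and iso_R: "fps_extend \<psi>t \<circ> fps_extend Rt' = fps_extend Rt \<circ> fps_extend \<psi>t"
    and iso_d: "fps_extend \<psi>t \<circ> fps_extend dt' = fps_extend dt \<circ> fps_extend \<psi>t"
    for x y
    using iso by (auto simp: formal_isomorphism_def)
  have zero: "br x 0 = 0" "br 0 x = 0" "R 0 = 0" "d 0 = 0" for x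
    using L.br_diff_left[of 0 0 x] L.br_diff_right[of x 0 0] L.R_diff[of 0 0] L.d_diff[of 0 0]
    by simp_all
  have neg: "br x (- y) = - br x y" "br (- y) x = - br y x" "R (- x) = - R x" "d (- x) = - d x"
    for x y
    using L.br_diff_left[of 0 y x] L.br_diff_right[of x 0 y] L.R_diff[of 0 x] L.d_diff[of 0 x]
    by (simp_all add: zero)
  let ?c = fps_const
  note coeffs = fps_nth_extend start zero \<psi>0
  define p where "p = (\<lambda>x. - \<psi>t 1 x)"
  have "br x (p y) + br (p x) y - p (br x y) = \<mu>t 1 x y - \<mu>t' 1 x y" for x y
    using arg_cong[OF iso_br[of "?c x" "?c y"], of "\<lambda>s. fps_nth s 1"]
    by (simp add: coeffs p_def neg algebra_simps)
  moreover have "R (p x) - p (R x) = Rt 1 x - Rt' 1 x" for x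
    using arg_cong[OF fun_cong[OF iso_R, of "?c x"], of "\<lambda>s. fps_nth s 1"]
    by (simp add: coeffs p_def neg algebra_simps)
  moreover have "d (p x) - p (d x) = dt 1 x - dt' 1 x" for x
    using arg_cong[OF fun_cong[OF iso_d, of "?c x"], of "\<lambda>s. fps_nth s 1"]
    by (simp add: coeffs p_def neg algebra_simps)
  ultimately have "infinitesimal \<mu>t Rt dt - infinitesimal \<mu>t' Rt' dt' =
      D_RLD scale br R d 1 ((cochain1 p, 0), 0)"
    unfolding L.D_RLD_1
    by (auto simp: infinitesimal_def cochain1_def cochain2_def fun_eq_iff split: list.splits)
  moreover have "module_hom scale scale p"
    using hom unfolding p_def by (simp add: module_hom_iff)
  then have "((cochain1 p, 0), 0) \<in> RLD_cochains scale 1"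
    using cochain1_in_alt_hom by (auto simp: RLD_cochains_def cochains_R_def)
  ultimately show ?thesis
    by (simp add: RLD_coboundaries_def)
qed

theorem theorem4p2:
  fixes scale :: "'k::field \<Rightarrow> 'v::ab_group_add \<Rightarrow> 'v"
    and \<mu> :: "'v \<Rightarrow> 'v \<Rightarrow> 'v" and R d :: "'v \<Rightarrow> 'v"
    and \<mu>t \<mu>t' :: "nat \<Rightarrow> 'v \<Rightarrow> 'v \<Rightarrow> 'v" and Rt Rt' dt dt' :: "nat \<Rightarrow> 'v \<Rightarrow> 'v"
  assumes "vector_space scale"
    and "reynolds_lieder_pair scale \<mu> R d"
    and "formal_deformation scale \<mu> R d \<mu>t Rt dt"
    and "formal_deformation scale \<mu> R d \<mu>t' Rt' dt'"
    and "equivalent_deformations scale \<mu>t Rt dt \<mu>t' Rt' dt'"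
  shows "infinitesimal \<mu>t Rt dt \<in> RLD_cocycles scale \<mu> R d 2 \<and>
         infinitesimal \<mu>t' Rt' dt' \<in> RLD_cocycles scale \<mu> R d 2 \<and>
         RLD_class scale \<mu> R d 2 (infinitesimal \<mu>t Rt dt) \<in> RLD_cohomology scale \<mu> R d 2 \<and>
         RLD_class scale \<mu> R d 2 (infinitesimal \<mu>t Rt dt) =
         RLD_class scale \<mu> R d 2 (infinitesimal \<mu>t' Rt' dt')"
proof -
  let ?c = "infinitesimal \<mu>t Rt dt" and ?c' = "infinitesimal \<mu>t' Rt' dt'"
  have cocycles: "?c \<in> RLD_cocycles scale \<mu> R d 2" "?c' \<in> RLD_cocycles scale \<mu> R d 2"
    using assms infinitesimal_in_cocycles by blast+
  have "?c - ?c' \<in> RLD_coboundaries scale \<mu> R d 2"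
    using assms infinitesimal_diff_coboundary unfolding equivalent_deformations_def by blast
  then have "(?c, ?c') \<in> RLD_cohomologous scale \<mu> R d 2"
    using cocycles by (simp add: RLD_cohomologous_def)
  then have "RLD_class scale \<mu> R d 2 ?c = RLD_class scale \<mu> R d 2 ?c'"
    unfolding RLD_class_def
    by (rule equiv_class_eq[OF reynolds_lieder_pair.equiv_cohomologous[OF assms(2)]])
  moreover have "RLD_class scale \<mu> R d 2 ?c \<in> RLD_cohomology scale \<mu> R d 2"
    unfolding RLD_class_def RLD_cohomology_def using cocycles(1) by (rule quotientI)
  ultimately show ?thesis
    using cocycles by simp
qed

end
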